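(* Let $(X,<)$ be a compact linearly ordered space and let $m\geq 1$. Then the map $\tilde{\varrho}:\Delta_{2m}(X)/{\approx}\ \to\mathcal{C}_m(X)$ given by $\tilde{\varrho}([x])=\varrho(x)$ is a homeomorphism.
   Context: A linearly ordered space is a linearly ordered set with the order topology. Elements $x\in{}^{k}X$ of a finite power are regarded as functions $x:k\to X$, $k=\{0,\dots,k-1\}$; ${}^kX$ has the product topology. $\Delta_{k}(X)=\{x\in{}^{k}X: x(i)\le x(i+1)\text{ for all } i\in k-1\}$ has the subspace topology. $\operatorname{Exp}(X)$ is the set of all non-empty closed subsets of $X$ with the Vietoris topology, generated by the subbase of all sets $[V]=\{F\in\operatorname{Exp}(X):F\subset V\}$ and $\langle V\rangle=\{F\in\operatorname{Exp}(X):F\cap V\neq\emptyset\}$, $V$ a non-empty open subset of $X$. $\mathcal{C}_m(X)\subset\operatorname{Exp}(X)$ is the subspace of all unions of at most $m$ non-empty closed intervals $[a,b]=\{z\in X:a\le z\le b\}$ ($a\le b$ in $X$). The map $\varrho:\Delta_{2m}(X)\to\mathcal{C}_m(X)$ is $\varrho(x)=\bigcup_{i\in m}[x(2i),x(2i+1)]$. The equivalence relation $\approx$ on $\Delta_{2m}(X)$ is defined by $x\approx y$ iff $\varrho(x)=\varrho(y)$; $[x]$ denotes the equivalence class of $x$, and $\Delta_{2m}(X)/{\approx}$ has the quotient topology. *)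

theory Defs
  imports "HOL-Analysis.Analysis"
begin

text \<open>
  A linearly ordered space is a type of class \<^class>\<open>linorder_topology\<close>, the underlying set
  being the whole type.
\<close>

text \<open>
  Elements of the \<open>k\<close>-th power are the functions on \<open>{..<k}\<close>, extended by
  \<^const>\<open>undefined\<close> outside of it, as required by \<^const>\<open>product_topology\<close>.
\<close>

definition Delta :: "nat \<Rightarrow> (nat \<Rightarrow> 'a::linorder_topology) set" where
  "Delta k = {x \<in> {..<k} \<rightarrow>\<^sub>E UNIV. \<forall>i < k - 1. x i \<le> x (i + 1)}"

definition Delta_topology :: "nat \<Rightarrow> (nat \<Rightarrow> 'a::linorder_topology) topology" where
  "Delta_topology k = subtopology (product_topology (\<lambda>_. euclidean) {..<k}) (Delta k)"

lemma topspace_Delta_topology [simp]: "topspace (Delta_topology k) = Delta k"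
  by (auto simp: Delta_topology_def Delta_def)

definition Exp :: "'a::topological_space set set" where
  "Exp = {F. F \<noteq> {} \<and> closed F}"

definition vietoris_topology :: "'a::topological_space set topology" where
  "vietoris_topology = topology_generated_by
     ({{F \<in> Exp. F \<subseteq> V} | V. open V \<and> V \<noteq> {}} \<union>
      {{F \<in> Exp. F \<inter> V \<noteq> {}} | V. open V \<and> V \<noteq> {}})"

lemma topspace_vietoris_topology [simp]:
  "topspace (vietoris_topology :: 'a::topological_space set topology) = Exp"
proof
  show "topspace (vietoris_topology :: 'a set topology) \<subseteq> Exp"
    unfolding vietoris_topology_def topology_generated_by_topspace by blast
  have "Exp \<in> {{F \<in> Exp. F \<subseteq> V} | V::'a set. open V \<and> V \<noteq> {}}"
    by (rule CollectI, rule exI[of _ UNIV]) auto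
  then show "Exp \<subseteq> topspace (vietoris_topology :: 'a set topology)"
    unfolding vietoris_topology_def topology_generated_by_topspace by blast
qed

definition interval_unions :: "nat \<Rightarrow> 'a::linorder_topology set set" where
  "interval_unions m = {F \<in> Exp. \<exists>I. finite I \<and> card I \<le> m \<and>
     I \<subseteq> {{a..b} | a b. a \<le> b} \<and> F = \<Union>I}"

definition interval_unions_topology :: "nat \<Rightarrow> 'a::linorder_topology set topology" where
  "interval_unions_topology m = subtopology vietoris_topology (interval_unions m)"

lemma topspace_interval_unions_topology [simp]:
  "topspace (interval_unions_topology m) = interval_unions m"
  by (auto simp: interval_unions_topology_def interval_unions_def)

definition rho :: "nat \<Rightarrow> (nat \<Rightarrow> 'a::linorder_topology) \<Rightarrow> 'a set" where
  "rho m x = (\<Union>i<m. {x (2 * i)..x (2 * i + 1)})"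

definition rho_rel :: "nat \<Rightarrow> ((nat \<Rightarrow> 'a::linorder_topology) \<times> (nat \<Rightarrow> 'a)) set" where
  "rho_rel m = {(x, y). x \<in> Delta (2 * m) \<and> y \<in> Delta (2 * m) \<and> rho m x = rho m y}"

lemma equiv_rho_rel: "equiv (Delta (2 * m)) (rho_rel m)"
  by (rule equivI) (auto simp: rho_rel_def refl_on_def sym_def trans_def)

text \<open>
  The quotient topology on the set of equivalence classes: the finest topology for which
  the canonical projection \<open>x \<mapsto> r `` {x}\<close> is continuous.
\<close>

definition quotient_topology :: "'a topology \<Rightarrow> ('a \<times> 'a) set \<Rightarrow> 'a set topology" where
  "quotient_topology T r = topology (\<lambda>U. U \<subseteq> topspace T // r \<and>
     openin T {x \<in> topspace T. r `` {x} \<in> U})"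

lemma openin_quotient_topology:
  "openin (quotient_topology T r) U \<longleftrightarrow>
     U \<subseteq> topspace T // r \<and> openin T {x \<in> topspace T. r `` {x} \<in> U}"
proof -
  have "istopology (\<lambda>U. U \<subseteq> topspace T // r \<and> openin T {x \<in> topspace T. r `` {x} \<in> U})"
    unfolding istopology_def
  proof (intro conjI allI impI)
    fix S S'
    assume "S \<subseteq> topspace T // r \<and> openin T {x \<in> topspace T. r `` {x} \<in> S}"
      and "S' \<subseteq> topspace T // r \<and> openin T {x \<in> topspace T. r `` {x} \<in> S'}"
    moreover have "{x \<in> topspace T. r `` {x} \<in> S \<inter> S'} =
        {x \<in> topspace T. r `` {x} \<in> S} \<inter> {x \<in> topspace T. r `` {x} \<in> S'}" by auto
    ultimately show "S \<inter> S' \<subseteq> topspace T // r"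
      and "openin T {x \<in> topspace T. r `` {x} \<in> S \<inter> S'}" by auto
  next
    fix K
    assume K: "\<forall>S\<in>K. S \<subseteq> topspace T // r \<and> openin T {x \<in> topspace T. r `` {x} \<in> S}"
    then show "\<Union>K \<subseteq> topspace T // r" by blast
    have "{x \<in> topspace T. r `` {x} \<in> \<Union>K} = (\<Union>S\<in>K. {x \<in> topspace T. r `` {x} \<in> S})"
      by auto
    with K show "openin T {x \<in> topspace T. r `` {x} \<in> \<Union>K}" by auto
  qed
  then show ?thesis
    by (simp add: quotient_topology_def)
qed

lemma topspace_quotient_topology [simp]:
  "topspace (quotient_topology T r) = topspace T // r"
proof
  show "topspace (quotient_topology T r) \<subseteq> topspace T // r"
    using openin_quotient_topology openin_topspace by blast
  have "{x \<in> topspace T. r `` {x} \<in> topspace T // r} = topspace T"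
    by (auto intro: quotientI)
  then have "openin (quotient_topology T r) (topspace T // r)"
    by (simp add: openin_quotient_topology)
  then show "topspace T // r \<subseteq> topspace (quotient_topology T r)"
    by (rule openin_subset)
qed

text \<open>
  On an equivalence class all values of \<^const>\<open>rho\<close> agree, so the image below is a singleton.
\<close>

definition rho_tilde :: "nat \<Rightarrow> (nat \<Rightarrow> 'a::linorder_topology) set \<Rightarrow> 'a set" where
  "rho_tilde m c = the_elem (rho m ` c)"

lemma rho_tilde_class:
  assumes "x \<in> Delta (2 * m)"
  shows "rho_tilde m (rho_rel m `` {x}) = rho m x"
proof -
  have "rho m ` (rho_rel m `` {x}) = {rho m x}"
    using assms by (auto simp: rho_rel_def)
  then show ?thesis by (simp add: rho_tilde_def)
qed

end

theory Submission
  imports Defs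
begin

text \<open>
  The map \<^const>\<open>rho\<close> is a continuous surjection from the compact space \<open>\<Delta>\<^sub>2\<^sub>m(X)\<close> onto a
  Hausdorff space, hence a quotient map, and an injective factor of a quotient map through the
  canonical projection is a homeomorphism. Surjectivity is obtained by splitting off from a finite
  family of intervals one with the greatest upper endpoint and cutting the others off at its lower
  endpoint.
\<close>

section \<open>Perturbing the endpoints of an interval\<close>

text \<open>A perturbed interval exceeds \<open>{a..b}\<close> only to the left of \<open>a\<close>
  or to the right of \<open>b\<close>, so \<open>A\<close> and \<open>B\<close> can be chosen
  independently. The order of \<open>a'\<close> and \<open>b'\<close> is irrelevant, as an empty
  interval is contained in \<open>V\<close> anyway.\<close>

lemma atLeastAtMost_subset_open_nbhds:
  fixes a b :: "'a::linorder_topology"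
  assumes "open V" and "a \<le> b" and "{a..b} \<subseteq> V"
  obtains A B where "open A" "open B" "a \<in> A" "b \<in> B"
    "\<And>a' b'. a' \<in> A \<Longrightarrow> b' \<in> B \<Longrightarrow> {a'..b'} \<subseteq> V"
proof -
  have ab: "a \<in> V" "b \<in> V" using assms by auto
  obtain A where A: "open A" "a \<in> A" "\<And>a' z. a' \<in> A \<Longrightarrow> a' \<le> z \<Longrightarrow> z \<le> a \<Longrightarrow> z \<in> V"
  \<comment> \<open>If \<open>a\<close> is the least element, nothing lies to its left and
    \<open>UNIV\<close> serves as \<open>A\<close>; otherwise openness of \<open>V\<close> provides
    a bound \<open>c < a\<close>.\<close>
  proof (cases "\<exists>y. y < a")
    case True
    then obtain c where "c < a" "{c<..a} \<subseteq> V"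
      using open_left[OF \<open>open V\<close> ab(1)] by blast
    then show ?thesis by (intro that[of "{c<..}"]) (auto simp: subset_iff)
  next
    case False
    then have "z = a" if "z \<le> a" for z using that by (auto simp: le_less)
    then show ?thesis using ab(1) by (intro that[of UNIV]) auto
  qed
  obtain B where B: "open B" "b \<in> B" "\<And>b' z. b' \<in> B \<Longrightarrow> z \<le> b' \<Longrightarrow> b \<le> z \<Longrightarrow> z \<in> V"
  proof (cases "\<exists>y. b < y")
    case True
    then obtain c where "b < c" "{b..<c} \<subseteq> V"
      using open_right[OF \<open>open V\<close> ab(2)] by blast
    then show ?thesis by (intro that[of "{..<c}"]) (auto simp: subset_iff)
  next
    case False
    then have "z = b" if "b \<le> z" for z using that by (auto simp: le_less)
    then show ?thesis using ab(2) by (intro that[of UNIV]) auto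
  qed
  have "{a'..b'} \<subseteq> V" if "a' \<in> A" "b' \<in> B" for a' b'
  proof
    fix z assume z: "z \<in> {a'..b'}"
    consider "z \<le> a" | "b \<le> z" | "z \<in> {a..b}" by force
    then show "z \<in> V"
      using z A(3)[OF that(1)] B(3)[OF that(2)] assms(3) by cases auto
  qed
  with A(1) B(1) A(2) B(2) show ?thesis by (rule that)
qed

text \<open>Fix a common point \<open>z\<close>. If it is strictly inside, it stays inside after a
  small perturbation. If it is an endpoint, the perturbed endpoint is kept in \<open>V\<close>, and
  \<open>a' \<le> b'\<close> makes it a point of the new interval.\<close>

lemma atLeastAtMost_meets_open_nbhds:
  fixes a b :: "'a::linorder_topology"
  assumes "open V" and "{a..b} \<inter> V \<noteq> {}"
  obtains A B where "open A" "open B" "a \<in> A" "b \<in> B"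
    "\<And>a' b'. a' \<in> A \<Longrightarrow> b' \<in> B \<Longrightarrow> a' \<le> b' \<Longrightarrow> {a'..b'} \<inter> V \<noteq> {}"
proof -
  obtain z where z: "a \<le> z" "z \<le> b" "z \<in> V" using assms by auto
  consider "z = a" | "z = b" | "a < z" "z < b" using z by force
  then show ?thesis
  proof cases
    case 1
    with z assms(1) show ?thesis by (intro that[of V UNIV]) auto
  next
    case 2
    with z assms(1) show ?thesis by (intro that[of UNIV V]) auto
  next
    case 3
    with z show ?thesis
      by (intro that[of "{..<z}" "{z<..}"]) (auto simp: disjoint_iff intro!: exI[of _ z])
  qed
qed

section \<open>Continuity of \<open>rho\<close>\<close>

lemma continuous_map_Delta_coordinate:
  assumes "i < k"
  shows "continuous_map (Delta_topology k) euclidean (\<lambda>x. x i)"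
  unfolding Delta_topology_def using assms
  by (intro continuous_map_from_subtopology continuous_map_product_projection) simp

lemma openin_Delta_topology_box:
  assumes "i < k" "j < k" "open A" "open B"
  shows "openin (Delta_topology k) {x \<in> Delta k. x i \<in> A \<and> x j \<in> B}"
proof -
  have "openin (Delta_topology k)
      ({x \<in> topspace (Delta_topology k). x i \<in> A} \<inter> {x \<in> topspace (Delta_topology k). x j \<in> B})"
    using assms
    by (intro openin_Int openin_continuous_map_preimage[OF continuous_map_Delta_coordinate]) auto
  moreover have "{x \<in> topspace (Delta_topology k). x i \<in> A} \<inter>
      {x \<in> topspace (Delta_topology k). x j \<in> B} = {x \<in> Delta k. x i \<in> A \<and> x j \<in> B}"
    by auto
  ultimately show ?thesis by simp
qed

lemma Delta_pair_le:
  assumes "x \<in> Delta (2 * m)" "i < m"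
  shows "x (2 * i) \<le> x (2 * i + 1)"
proof -
  have "2 * i < 2 * m - 1" using assms(2) by linarith
  then show ?thesis using assms(1) by (auto simp: Delta_def)
qed

lemma openin_Delta_rho_subset:
  fixes V :: "'a::linorder_topology set"
  assumes "open V"
  shows "openin (Delta_topology (2 * m)) {x \<in> Delta (2 * m). rho m x \<subseteq> V}"
proof -
  have "openin (Delta_topology (2 * m)) {x \<in> Delta (2 * m). {x (2 * i)..x (2 * i + 1)} \<subseteq> V}"
    if i: "i < m" for i
  proof (subst openin_subopen, intro ballI)
    fix x assume "x \<in> {x \<in> Delta (2 * m). {x (2 * i)..x (2 * i + 1)} \<subseteq> V}"
    then have x: "x \<in> Delta (2 * m)" "{x (2 * i)..x (2 * i + 1)} \<subseteq> V" by auto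
    obtain A B where AB: "open A" "open B" "x (2 * i) \<in> A" "x (2 * i + 1) \<in> B"
      "\<And>a' b'. a' \<in> A \<Longrightarrow> b' \<in> B \<Longrightarrow> {a'..b'} \<subseteq> V"
      using atLeastAtMost_subset_open_nbhds[OF assms Delta_pair_le[OF x(1) i] x(2)] by blast
    have "openin (Delta_topology (2 * m)) {x \<in> Delta (2 * m). x (2 * i) \<in> A \<and> x (2 * i + 1) \<in> B}"
      using i AB by (intro openin_Delta_topology_box) auto
    with x(1) AB show "\<exists>T. openin (Delta_topology (2 * m)) T \<and> x \<in> T \<and>
        T \<subseteq> {x \<in> Delta (2 * m). {x (2 * i)..x (2 * i + 1)} \<subseteq> V}"
      by (intro exI[of _ "{x \<in> Delta (2 * m). x (2 * i) \<in> A \<and> x (2 * i + 1) \<in> B}"]) blast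
  qed
  \<comment> \<open>A union lies in \<open>V\<close> iff each of its members does, so finitely many
    open conditions are intersected. The factor \<open>topspace\<close> takes care of
    \<open>m = 0\<close>, where the bare intersection would be \<open>UNIV\<close>.\<close>
  then have "openin (Delta_topology (2 * m)) (topspace (Delta_topology (2 * m)) \<inter>
      (\<Inter>i\<in>{..<m}. {x \<in> Delta (2 * m). {x (2 * i)..x (2 * i + 1)} \<subseteq> V}))"
    by (intro openin_Int_Inter openin_topspace finite_imageI) auto
  moreover have "topspace (Delta_topology (2 * m)) \<inter>
      (\<Inter>i\<in>{..<m}. {x \<in> Delta (2 * m). {x (2 * i)..x (2 * i + 1)} \<subseteq> V})
      = {x \<in> Delta (2 * m). rho m x \<subseteq> V}"
    unfolding topspace_Delta_topology rho_def by blast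
  ultimately show ?thesis by simp
qed

text \<open>One interval meeting \<open>V\<close> is enough, so only the two coordinates bounding it
  need to be controlled.\<close>

lemma openin_Delta_rho_meets:
  fixes V :: "'a::linorder_topology set"
  assumes "open V"
  shows "openin (Delta_topology (2 * m)) {x \<in> Delta (2 * m). rho m x \<inter> V \<noteq> {}}"
proof (subst openin_subopen, intro ballI)
  fix x assume "x \<in> {x \<in> Delta (2 * m). rho m x \<inter> V \<noteq> {}}"
  then obtain i where x: "x \<in> Delta (2 * m)" and i: "i < m"
    and meets: "{x (2 * i)..x (2 * i + 1)} \<inter> V \<noteq> {}"
    unfolding rho_def by blast
  obtain A B where AB: "open A" "open B" "x (2 * i) \<in> A" "x (2 * i + 1) \<in> B"
    "\<And>a' b'. a' \<in> A \<Longrightarrow> b' \<in> B \<Longrightarrow> a' \<le> b' \<Longrightarrow> {a'..b'} \<inter> V \<noteq> {}"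
    using atLeastAtMost_meets_open_nbhds[OF assms meets] by metis
  let ?T = "{x \<in> Delta (2 * m). x (2 * i) \<in> A \<and> x (2 * i + 1) \<in> B}"
  have "openin (Delta_topology (2 * m)) ?T"
    using i AB by (intro openin_Delta_topology_box) auto
  moreover have "rho m y \<inter> V \<noteq> {}" if "y \<in> ?T" for y
  proof -
    have "{y (2 * i)..y (2 * i + 1)} \<inter> V \<noteq> {}"
      using that Delta_pair_le[OF _ i] by (intro AB(5)) auto
    then show ?thesis using i unfolding rho_def by blast
  qed
  ultimately show "\<exists>T. openin (Delta_topology (2 * m)) T \<and> x \<in> T \<and>
      T \<subseteq> {x \<in> Delta (2 * m). rho m x \<inter> V \<noteq> {}}"
    using x AB(3,4) by (intro exI[of _ ?T]) blast
qed

lemma rho_in_interval_unions: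
  assumes "x \<in> Delta (2 * m)" and "m \<ge> 1"
  shows "rho m x \<in> interval_unions m"
proof -
  let ?I = "(\<lambda>i. {x (2 * i)..x (2 * i + 1)}) ` {..<m}"
  have "closed (rho m x)" unfolding rho_def by (intro closed_UN) auto
  \<comment> \<open>Members of \<open>Exp\<close> are non-empty; this is where
    \<open>m \<ge> 1\<close> enters.\<close>
  moreover have "x 0 \<in> rho m x"
    using assms Delta_pair_le[OF assms(1), of 0] unfolding rho_def by (auto intro!: bexI[of _ 0])
  ultimately have "rho m x \<in> Exp" by (auto simp: Exp_def)
  moreover have "card ?I \<le> m" using card_image_le[of "{..<m}"] by force
  moreover have "?I \<subseteq> {{a..b} | a b. a \<le> b}"
    using Delta_pair_le[OF assms(1)] by blast
  ultimately show ?thesis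
    unfolding interval_unions_def by (auto simp: rho_def intro!: exI[of _ ?I])
qed

lemma continuous_map_rho:
  assumes "m \<ge> 1"
  shows "continuous_map (Delta_topology (2 * m)) (interval_unions_topology m)
    (rho m :: (nat \<Rightarrow> 'a::linorder_topology) \<Rightarrow> 'a set)"
  unfolding interval_unions_topology_def
proof (rule continuous_map_into_subtopology)
  show "rho m \<in> topspace (Delta_topology (2 * m)) \<rightarrow> (interval_unions m :: 'a set set)"
    using rho_in_interval_unions[OF _ assms] by auto
  have Exp: "rho m x \<in> Exp" if "x \<in> Delta (2 * m)" for x :: "nat \<Rightarrow> 'a"
    using rho_in_interval_unions[OF that assms] by (auto simp: interval_unions_def)
  show "continuous_map (Delta_topology (2 * m)) vietoris_topology
      (rho m :: (nat \<Rightarrow> 'a) \<Rightarrow> 'a set)"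
    unfolding vietoris_topology_def
  \<comment> \<open>It suffices to test preimages of the subbasic sets, whose two kinds are covered
    by the two openness lemmas for \<open>rho\<close>.\<close>
  proof (rule continuous_on_generated_topo)
    fix U assume "U \<in> {{F \<in> Exp. F \<subseteq> V} | V::'a set. open V \<and> V \<noteq> {}} \<union>
      {{F \<in> Exp. F \<inter> V \<noteq> {}} | V. open V \<and> V \<noteq> {}}"
    then obtain V where V: "open V" and U: "U = {F \<in> Exp. F \<subseteq> V} \<or> U = {F \<in> Exp. F \<inter> V \<noteq> {}}"
      by blast
    from U show "openin (Delta_topology (2 * m)) (rho m -` U \<inter> topspace (Delta_topology (2 * m)))"
    proof
      assume "U = {F \<in> Exp. F \<subseteq> V}"
      then have "rho m -` U \<inter> topspace (Delta_topology (2 * m)) = {x \<in> Delta (2 * m). rho m x \<subseteq> V}"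
        using Exp by auto
      then show ?thesis by (simp only: openin_Delta_rho_subset[OF V])
    next
      assume "U = {F \<in> Exp. F \<inter> V \<noteq> {}}"
      then have "rho m -` U \<inter> topspace (Delta_topology (2 * m)) =
          {x \<in> Delta (2 * m). rho m x \<inter> V \<noteq> {}}"
        using Exp by auto
      then show ?thesis by (simp only: openin_Delta_rho_meets[OF V])
    qed
  next
    have Union_eq: "\<Union>({{F \<in> Exp. F \<subseteq> V} | V::'a set. open V \<and> V \<noteq> {}} \<union>
        {{F \<in> Exp. F \<inter> V \<noteq> {}} | V. open V \<and> V \<noteq> {}}) = Exp"
      using topspace_vietoris_topology
      unfolding vietoris_topology_def topology_generated_by_topspace .
    show "rho m ` topspace (Delta_topology (2 * m)) \<subseteq>
        \<Union>({{F \<in> Exp. F \<subseteq> V} | V::'a set. open V \<and> V \<noteq> {}} \<union>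
          {{F \<in> Exp. F \<inter> V \<noteq> {}} | V. open V \<and> V \<noteq> {}})"
      unfolding Union_eq topspace_Delta_topology using Exp by blast
  qed
qed

section \<open>Surjectivity of \<open>rho\<close>\<close>

lemma rho_Suc: "rho (Suc m) x = rho m x \<union> {x (2 * m)..x (2 * m + 1)}"
  by (auto simp: rho_def lessThan_Suc)

lemma rho_surj_atLeastAtMost:
  fixes a b :: "'a::linorder_topology"
  assumes "a \<le> b" and "m \<ge> 1"
  shows "{a..b} \<in> rho m ` Delta (2 * m)"
proof -
  \<comment> \<open>The tuple \<open>(a, b, b, ..., b)\<close>: the first pair spans the interval,
    all later pairs are the degenerate interval \<open>{b..b}\<close>.\<close>
  define x where "x = (\<lambda>i\<in>{..<2 * m}. if i = 0 then a else b)"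
  have "x \<in> Delta (2 * m)" using assms by (auto simp: x_def Delta_def)
  moreover have "rho m x = {a..b}"
  proof
    show "rho m x \<subseteq> {a..b}" using assms by (auto simp: rho_def x_def split: if_splits intro: order_trans)
    have "{x (2 * 0)..x (2 * 0 + 1)} \<subseteq> rho m x"
      unfolding rho_def using assms(2) by (intro UN_upper) simp
    then show "{a..b} \<subseteq> rho m x" using assms(2) by (simp add: x_def)
  qed
  ultimately show ?thesis by blast
qed

text \<open>The pair \<open>a\<close>, \<open>b\<close> is appended to a tuple representing
  \<open>F\<close>. Monotonicity survives because the last old coordinate belongs to
  \<open>F\<close> and hence is at most \<open>a\<close>.\<close>

lemma rho_image_Un_atLeastAtMost:
  fixes a b :: "'a::linorder_topology"
  assumes F: "F \<in> rho m ` Delta (2 * m)" and "m \<ge> 1" and "F \<subseteq> {..a}" and "a \<le> b"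
  shows "F \<union> {a..b} \<in> rho (Suc m) ` Delta (2 * Suc m)"
proof -
  obtain x where x: "x \<in> Delta (2 * m)" "F = rho m x" using F by blast
  define y where "y = x(2 * m := a, 2 * m + 1 := b)"
  have "x (2 * (m - 1) + 1) \<in> rho m x"
    using Delta_pair_le[OF x(1), of "m - 1"] \<open>m \<ge> 1\<close> unfolding rho_def
    by (intro UN_I[of "m - 1"]) auto
  moreover have "2 * (m - 1) + 1 = 2 * m - 1" using \<open>m \<ge> 1\<close> by simp
  ultimately have last: "x (2 * m - 1) \<le> a" using assms(3) x(2) by auto
  have "y i \<le> y (i + 1)" if "i < 2 * Suc m - 1" for i
  proof -
    \<comment> \<open>Two neighbours are both old, straddle the junction, or are the new
      pair.\<close>
    have "i < 2 * m - 1 \<or> i = 2 * m - 1 \<or> i = 2 * m"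
      using that by arith
    then consider "i < 2 * m - 1" | "i = 2 * m - 1" | "i = 2 * m" by blast
    then show ?thesis
    proof cases
      case 1
      then show ?thesis using x(1) by (auto simp: y_def Delta_def)
    next
      case 2
      then show ?thesis using last \<open>m \<ge> 1\<close> by (auto simp: y_def)
    next
      case 3
      then show ?thesis using \<open>a \<le> b\<close> by (simp add: y_def)
    qed
  qed
  then have "y \<in> Delta (2 * Suc m)"
    using x(1) by (auto simp: Delta_def y_def PiE_iff extensional_def)
  moreover have "rho m y = rho m x"
    unfolding rho_def y_def by (intro SUP_cong) auto
  then have "rho (Suc m) y = F \<union> {a..b}"
    unfolding rho_Suc by (simp add: x(2) y_def)
  ultimately show ?thesis by blast
qed

text \<open>Cutting the other intervals at \<open>l M\<close> loses no points of the union: what is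
  removed lies between \<open>l M\<close> and \<open>u M\<close>, since no upper endpoint exceeds
  \<open>u M\<close>. The cut intervals are then represented by induction, and
  \<open>{l M..u M}\<close> is appended. The cardinality is only bounded by \<open>m\<close> because
  cut intervals may become empty or coincide.\<close>

lemma Union_intervals_in_rho_image:
  fixes I :: "'a::linorder_topology set set"
  assumes "finite I" "card I \<le> m" "I \<noteq> {}" "I \<subseteq> {{a..b} | a b. a \<le> b}"
  shows "\<Union>I \<in> rho m ` Delta (2 * m)"
  using assms
proof (induction m arbitrary: I)
  case 0
  then show ?case by simp
next
  case (Suc m)
  have "\<forall>S\<in>I. \<exists>l u. S = {l..u} \<and> l \<le> u" using Suc.prems(4) by blast
  then obtain l u where lu: "\<And>S. S \<in> I \<Longrightarrow> S = {l S..u S} \<and> l S \<le> u S" by metis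
  then have mem: "z \<in> S \<longleftrightarrow> l S \<le> z \<and> z \<le> u S" if "S \<in> I" for z S
    using that by (metis atLeastAtMost_iff)
  have "Max (u ` I) \<in> u ` I" using Suc.prems by (intro Max_in) auto
  then obtain M where M: "M \<in> I" "u M = Max (u ` I)" by auto
  then have u_le: "u S \<le> u M" if "S \<in> I" for S using that Suc.prems(1) by simp
  \<comment> \<open>An interval starting above \<open>l M\<close> is cut to the empty set, which has
    to be discarded to keep a family of non-empty intervals.\<close>
  define J where "J = (\<lambda>S. S \<inter> {..l M}) ` (I - {M}) - {{}}"
  have "card J \<le> card ((\<lambda>S. S \<inter> {..l M}) ` (I - {M}))"
    unfolding J_def using Suc.prems(1) by (intro card_mono) auto
  also have "\<dots> \<le> card (I - {M})" using Suc.prems(1) by (intro card_image_le) auto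
  also have "\<dots> \<le> m" using Suc.prems(1,2) M(1) by simp
  finally have card_J: "card J \<le> m" .
  have fin_J: "finite J" using Suc.prems(1) by (simp add: J_def)
  have "T \<in> {{a..b} | a b. a \<le> b}" if T: "T \<in> J" for T
  proof -
    obtain S where S: "S \<in> I" "T = S \<inter> {..l M}" "T \<noteq> {}" using T unfolding J_def by blast
    then have "T = {l S..min (u S) (l M)}" by (auto simp: mem)
    then show ?thesis using S(3) by auto
  qed
  then have J_int: "J \<subseteq> {{a..b} | a b. a \<le> b}" by blast
  have M_le: "l M \<le> u M" using lu M(1) by blast
  have Union_I: "\<Union>I = \<Union>J \<union> {l M..u M}"
  proof
    show "\<Union>J \<union> {l M..u M} \<subseteq> \<Union>I" using M(1) by (auto simp: J_def mem)
    show "\<Union>I \<subseteq> \<Union>J \<union> {l M..u M}"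
    proof
      fix z assume "z \<in> \<Union>I"
      then obtain S where S: "S \<in> I" "z \<in> S" by blast
      show "z \<in> \<Union>J \<union> {l M..u M}"
      proof (cases "l M \<le> z")
        case True
        then show ?thesis using S u_le[OF S(1)] by (auto simp: mem[OF S(1)])
      next
        case False
        then have "S \<noteq> M" using S by (auto simp: mem)
        then have "S \<inter> {..l M} \<in> J" using False S unfolding J_def by auto
        moreover have "z \<in> S \<inter> {..l M}" using False S(2) by auto
        ultimately show ?thesis by blast
      qed
    qed
  qed
  show ?case
  \<comment> \<open>If nothing is left of the other intervals, the union is the single interval
    \<open>{l M..u M}\<close>, which is represented by padding.\<close>
  proof (cases "J = {}")
    case True
    then show ?thesis using rho_surj_atLeastAtMost[OF M_le, of "Suc m"] Union_I by simp
  next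
    case False
    then have "m \<ge> 1" using card_J fin_J by (cases m) auto
    then show ?thesis
      unfolding Union_I using Suc.IH[OF fin_J card_J False J_int] M_le
      by (intro rho_image_Un_atLeastAtMost) (auto simp: J_def)
  qed
qed

lemma rho_image_Delta:
  assumes "m \<ge> 1"
  shows "rho m ` Delta (2 * m) = (interval_unions m :: 'a::linorder_topology set set)"
proof
  show "rho m ` Delta (2 * m) \<subseteq> (interval_unions m :: 'a set set)"
    using rho_in_interval_unions[OF _ assms] by blast
  show "(interval_unions m :: 'a set set) \<subseteq> rho m ` Delta (2 * m)"
  proof
    fix F :: "'a set" assume "F \<in> interval_unions m"
    \<comment> \<open>\<open>F \<noteq> {}\<close> rules out the empty family.\<close>
    then obtain I where "finite I" "card I \<le> m" "I \<subseteq> {{a..b} | a b. a \<le> b}" "F = \<Union>I" "F \<noteq> {}"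
      by (auto simp: interval_unions_def Exp_def)
    then show "F \<in> rho m ` Delta (2 * m)"
      using Union_intervals_in_rho_image[of I m] by auto
  qed
qed

section \<open>Compactness of the domain, Hausdorffness of the target\<close>

text \<open>The power is compact by Tychonoff's theorem, and \<open>Delta k\<close> is closed in it
  because the order relation is closed in the square.\<close>

lemma compact_space_Delta_topology:
  assumes "compact (UNIV :: 'a::linorder_topology set)"
  shows "compact_space (Delta_topology k :: (nat \<Rightarrow> 'a) topology)"
proof -
  let ?P = "product_topology (\<lambda>_. euclidean :: 'a topology) {..<k}"
  have "compact_space (euclidean :: 'a topology)"
    using assms by (simp add: compact_space_def)
  then have P: "compact_space ?P" by (simp add: compact_space_product_topology)
  have "closedin ?P {x \<in> topspace ?P. x i \<le> x (i + 1)}" if "i < k - 1" for i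
  proof -
    have "continuous_map ?P euclidean (\<lambda>x. (x i, x (i + 1)))"
      unfolding prod_topology_euclidean[symmetric] using that
      by (intro continuous_map_pairedI continuous_map_product_projection) auto
    then have "closedin ?P {x \<in> topspace ?P. (x i, x (i + 1)) \<in> {(a, b) | a b. a \<le> b}}"
      by (rule closedin_continuous_map_preimage) (rule closed_closedin[THEN iffD1, OF closed_subdiagonal])
    then show ?thesis by simp
  qed
  \<comment> \<open>Inserting \<open>topspace ?P\<close> keeps the family non-empty when
    \<open>k \<le> 1\<close> and there are no order conditions.\<close>
  then have "closedin ?P (\<Inter>(insert (topspace ?P)
      ((\<lambda>i. {x \<in> topspace ?P. x i \<le> x (i + 1)}) ` {..<k - 1})))"
    by (intro closedin_Inter) (auto simp del: topspace_product_topology)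
  moreover have "\<Inter>(insert (topspace ?P)
      ((\<lambda>i. {x \<in> topspace ?P. x i \<le> x (i + 1)}) ` {..<k - 1})) = Delta k"
    by (auto simp: Delta_def)
  ultimately have "compactin ?P (Delta k)" using closedin_compact_space[OF P] by metis
  then show ?thesis unfolding Delta_topology_def by (rule compact_space_subtopology)
qed

text \<open>If \<open>p\<close> lies in \<open>F\<close> but not in the compact set
  \<open>G\<close>, disjoint open \<open>U\<close> around \<open>p\<close> and \<open>V\<close>
  around \<open>G\<close> exist. A set meeting \<open>U\<close> is not contained in
  \<open>V\<close>, so the corresponding subbasic sets separate \<open>F\<close> from
  \<open>G\<close>.\<close>

lemma Hausdorff_space_vietoris_topology:
  assumes "compact (UNIV :: 'a::t2_space set)"
  shows "Hausdorff_space (vietoris_topology :: 'a set topology)"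
proof -
  have separate: "\<exists>U V. openin vietoris_topology U \<and> openin vietoris_topology V \<and>
      F \<in> U \<and> G \<in> V \<and> disjnt U V"
    if FG: "F \<in> Exp" "G \<in> Exp" and p: "p \<in> F" "p \<notin> G" for F G :: "'a set" and p
  proof -
    have "compact G" using closed_Int_compact[of G UNIV] FG(2) assms by (simp add: Exp_def)
    moreover have "Hausdorff_space (euclidean :: 'a topology)"
      unfolding Hausdorff_space_def disjnt_def using hausdorff by fastforce
    ultimately obtain U V where UV: "open U" "open V" "{p} \<subseteq> U" "G \<subseteq> V" "disjnt U V"
      using Hausdorff_space_compact_separation[of euclidean "{p}" G] p(2)
      by (auto simp: disjnt_def)
    have "V \<noteq> {}" using UV(4) FG(2) by (auto simp: Exp_def)
    then have "openin vietoris_topology {F \<in> Exp. F \<subseteq> V}"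
      unfolding vietoris_topology_def using UV(2) by (intro topology_generated_by_Basis) blast
    moreover have "openin vietoris_topology {F \<in> Exp. F \<inter> U \<noteq> {}}"
      unfolding vietoris_topology_def using UV(1,3) by (intro topology_generated_by_Basis) blast
    moreover have "disjnt {F \<in> Exp. F \<inter> U \<noteq> {}} {F \<in> Exp. F \<subseteq> V}"
      using UV(5) unfolding disjnt_def by blast
    ultimately show ?thesis using UV(3,4) FG p(1) by blast
  qed
  show ?thesis
    unfolding Hausdorff_space_def topspace_vietoris_topology
  proof (intro allI impI)
    fix F G :: "'a set" assume FG: "F \<in> Exp \<and> G \<in> Exp \<and> F \<noteq> G"
    then consider p where "p \<in> F" "p \<notin> G" | p where "p \<in> G" "p \<notin> F" by blast
    then show "\<exists>U V. openin vietoris_topology U \<and> openin vietoris_topology V \<and>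
        F \<in> U \<and> G \<in> V \<and> disjnt U V"
      using separate FG by cases (blast, metis disjnt_sym)
  qed
qed

section \<open>Passage to the quotient\<close>

lemma quotient_map_projection:
  "quotient_map T (quotient_topology T r) (\<lambda>x. r `` {x})"
  by (auto simp: quotient_map_def openin_quotient_topology quotient_def)

lemma inj_on_rho_tilde: "inj_on (rho_tilde m) (Delta (2 * m) // rho_rel m)"
proof (rule inj_onI)
  fix c d :: "(nat \<Rightarrow> 'a) set"
  assume "c \<in> Delta (2 * m) // rho_rel m" "d \<in> Delta (2 * m) // rho_rel m"
    and eq: "rho_tilde m c = rho_tilde m d"
  then obtain x y where "x \<in> Delta (2 * m)" "c = rho_rel m `` {x}"
    "y \<in> Delta (2 * m)" "d = rho_rel m `` {y}"
    by (auto elim!: quotientE)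
  moreover from this have "rho m x = rho m y" using eq by (simp add: rho_tilde_class)
  ultimately show "c = d" by (auto simp: rho_rel_def)
qed

theorem corollary4p3:
  fixes m :: nat
  assumes "compact (UNIV :: 'a::linorder_topology set)"
    and "m \<ge> 1"
  shows "homeomorphic_map
           (quotient_topology (Delta_topology (2 * m)) (rho_rel m))
           (interval_unions_topology m)
           (rho_tilde m :: (nat \<Rightarrow> 'a) set \<Rightarrow> 'a set)"
proof -
  let ?D = "Delta_topology (2 * m) :: (nat \<Rightarrow> 'a) topology"
  let ?C = "interval_unions_topology m :: 'a set topology"
  let ?p = "\<lambda>x :: nat \<Rightarrow> 'a. rho_rel m `` {x}"
  have "Hausdorff_space ?C"
    unfolding interval_unions_topology_def
    by (intro Hausdorff_space_subtopology Hausdorff_space_vietoris_topology assms(1))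
  \<comment> \<open>A continuous map from a compact space to a Hausdorff space is closed; being onto
    as well, it is a quotient map.\<close>
  then have "quotient_map ?D ?C (rho m)"
    using assms by (intro continuous_imp_quotient_map continuous_map_rho
        compact_space_Delta_topology) (simp_all add: rho_image_Delta)
  then have rho: "quotient_map ?D ?C (rho_tilde m \<circ> ?p)"
    by (rule quotient_map_eq) (simp add: rho_tilde_class)
  have p: "quotient_map ?D (quotient_topology ?D (rho_rel m)) ?p"
    by (rule quotient_map_projection)
  have "continuous_map (quotient_topology ?D (rho_rel m)) ?C (rho_tilde m)"
    using p quotient_imp_continuous_map[OF rho] by (rule continuous_compose_quotient_map)
  \<comment> \<open>If a composite of continuous maps is a quotient map, so is its outer factor.
    With injectivity this is exactly \<open>homeomorphic_map\<close>.\<close>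
  then have "quotient_map (quotient_topology ?D (rho_rel m)) ?C (rho_tilde m)"
    by (rule quotient_map_from_composition[OF quotient_imp_continuous_map[OF p] _ rho])
  then show ?thesis
    by (simp add: homeomorphic_map_def inj_on_rho_tilde)
qed

end
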